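(* Let $(X,d)$ be a compact metric space, let $n\ge 1$, let $f_1,\dots,f_n:X\to X$ be continuous surjective maps, and let $(X,\mathbb{F})$ be the non-autonomous dynamical system generated by the finite family $\mathbb{F}=\{f_1,\dots,f_n\}$. If the autonomous system $(X,\,f_n\circ f_{n-1}\circ\cdots\circ f_1)$ is transitive, then $(X,\mathbb{F})$ is transitive.
   Context: $\mathbb{N}$ denotes the positive integers. The non-autonomous system generated by the finite ordered family $\mathbb{F}=\{f_1,\dots,f_n\}$ is obtained by repeating the maps cyclically: for every $k\ge1$ put $f_k=f_{1+((k-1)\bmod n)}$, and let $\omega_k=f_k\circ f_{k-1}\circ\cdots\circ f_1$. The system $(X,\mathbb{F})$ is transitive if for each pair of non-empty open sets $U,V\subseteq X$ there exists $k\in\mathbb{N}$ such that $\omega_k(U)\cap V\neq\emptyset$. An autonomous system $(X,g)$ is transitive if for each pair of non-empty open sets $U,V\subseteq X$ there exists $k\in\mathbb{N}$ such that $g^k(U)\cap V\neq\emptyset$. *)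

theory Defs
  imports "HOL-Analysis.Analysis"
begin

(* Indices are positive: f 0 is never used. *)

primrec omega :: "(nat \<Rightarrow> 'a \<Rightarrow> 'a) \<Rightarrow> nat \<Rightarrow> 'a \<Rightarrow> 'a" where
  "omega f 0 = id"
| "omega f (Suc k) = f (Suc k) \<circ> omega f k"

definition cyclic_ext :: "nat \<Rightarrow> (nat \<Rightarrow> 'a \<Rightarrow> 'a) \<Rightarrow> nat \<Rightarrow> 'a \<Rightarrow> 'a" where
  "cyclic_ext n f k = f (1 + (k - 1) mod n)"

definition nonautonomous_transitive :: "'a topology \<Rightarrow> (nat \<Rightarrow> 'a \<Rightarrow> 'a) \<Rightarrow> bool" where
  "nonautonomous_transitive T f \<longleftrightarrow>
     (\<forall>U V. openin T U \<and> U \<noteq> {} \<and> openin T V \<and> V \<noteq> {} \<longrightarrow>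
        (\<exists>k\<ge>1. omega f k ` U \<inter> V \<noteq> {}))"

definition autonomous_transitive :: "'a topology \<Rightarrow> ('a \<Rightarrow> 'a) \<Rightarrow> bool" where
  "autonomous_transitive T g \<longleftrightarrow>
     (\<forall>U V. openin T U \<and> U \<noteq> {} \<and> openin T V \<and> V \<noteq> {} \<longrightarrow>
        (\<exists>k\<ge>1. (g ^^ k) ` U \<inter> V \<noteq> {}))"

end

theory Submission
  imports Defs
begin

text \<open>After each full cycle of n maps the family starts afresh, so at time m * n the cyclic
  system has applied g = \<open>omega f n\<close> exactly m times
  (\<open>omega_cyclic_ext_mult\<close>). Every iterate of g is thus some \<omega>_k, and a time k
  at which g carries a point of U into V yields the time k * n for the cyclic system.\<close>

text \<open>Runs through one more cycle map by map. The first assumption is the induction hypothesis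
  of \<open>omega_cyclic_ext_mult\<close>, whose induction step is the case j = n.\<close>

lemma omega_cyclic_ext_add:
  assumes "omega (cyclic_ext n f) (m * n) = omega f n ^^ m" and "j \<le> n"
  shows "omega (cyclic_ext n f) (m * n + j) = omega f j \<circ> (omega f n ^^ m)"
  using assms(2)
proof (induction j)
  case 0
  then show ?case using assms(1) by simp
next
  case (Suc j)
  \<comment> \<open>Here j < n, so (m * n + j) mod n = j; the shift by 1 in
    \<open>cyclic_ext\<close> gives the index \<open>Suc j\<close>.\<close>
  then have "cyclic_ext n f (Suc (m * n + j)) = f (Suc j)"
    by (simp add: cyclic_ext_def)
  with Suc show ?case by (simp add: comp_assoc)
qed

lemma omega_cyclic_ext_mult: "omega (cyclic_ext n f) (m * n) = omega f n ^^ m"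
proof (induction m)
  case 0
  then show ?case by simp
next
  case (Suc m)
  then show ?case using omega_cyclic_ext_add[of n f m n] by (simp add: add.commute)
qed

theorem lemma2:
  fixes X :: "'a set" and d :: "'a \<Rightarrow> 'a \<Rightarrow> real"
    and n :: nat and f :: "nat \<Rightarrow> 'a \<Rightarrow> 'a"
  assumes "Metric_space X d"
    and "compact_space (Metric_space.mtopology X d)"
    and "n \<ge> 1"
    and "\<And>i. i \<in> {1..n} \<Longrightarrow>
           continuous_map (Metric_space.mtopology X d) (Metric_space.mtopology X d) (f i)"
    and "\<And>i. i \<in> {1..n} \<Longrightarrow> f i ` X = X"
    and "autonomous_transitive (Metric_space.mtopology X d) (omega f n)"
  shows "nonautonomous_transitive (Metric_space.mtopology X d) (cyclic_ext n f)"
  unfolding nonautonomous_transitive_def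
proof (intro allI impI)
  let ?T = "Metric_space.mtopology X d"
  fix U V
  assume "openin ?T U \<and> U \<noteq> {} \<and> openin ?T V \<and> V \<noteq> {}"
  with assms(6) obtain k where "k \<ge> 1" and "(omega f n ^^ k) ` U \<inter> V \<noteq> {}"
    unfolding autonomous_transitive_def by blast
  \<comment> \<open>n \<ge> 1 keeps the time k * n positive.\<close>
  with assms(3) have "k * n \<ge> 1 \<and> omega (cyclic_ext n f) (k * n) ` U \<inter> V \<noteq> {}"
    by (simp add: omega_cyclic_ext_mult)
  then show "\<exists>k\<ge>1. omega (cyclic_ext n f) k ` U \<inter> V \<noteq> {}" by blast
qed

end
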